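(* Let $(F,\partial)$, $\mathbf{B}$, $C$, $W$, $\tau$, $W_0$ and $P=(P_0,P_1)$ be as in the context. An element $(\partial,\mathbf{u})\in W_0$ is $G$-equivalent to some element $(\delta,\mathbf{v})\in W_0$ with $\mathbf{v}\in C^l$ (i.e. all components of $\mathbf{v}$ are constants) if and only if all components of $$\tau^{\partial}\langle P^{\partial}\langle\mathbf{u}\rangle;\mathbf{u}\rangle$$ are constants (elements of $C$). Here $(\partial,\mathbf{u})$ and $(\delta,\mathbf{v})$ are $G$-equivalent if there exists $(h,g)\in GL(n,F)\times GL^{\partial}(m,F)$ with $\delta=g^{-1}\partial$ and $\mathbf{v}=\tau^{\partial}\langle h,g;\mathbf{u}\rangle$.
   Context: Fix natural numbers $l,m,n$. $(F,\partial)$ is a field with commuting derivations $\partial^1,\dots,\partial^m$ which are linearly independent over $F$; $\partial$ also denotes the column with entries $\partial^1,\dots,\partial^m$; $C=\{a\in F:\partial^1a=\dots=\partial^ma=0\}$ is the constant field. For a column $\delta=(\delta^1,\dots,\delta^m)^t$ of commuting derivations of $F$ put $GL^{\delta}(m,F)=\{g=(g^i_j)\in GL(m,F): \delta^i g^j_k=\delta^j g^i_k \text{ for all } i,j,k\}$, where $g^i_j$ is the entry in row $i$, column $j$. For $g\in GL(m,F)$, $g^{-1}\delta$ is the column obtained by matrix multiplication. $\mathbf{B}=\{g^{-1}\partial: g\in GL^{\partial}(m,F)\}$; for $\delta=g^{-1}\partial\in \mathbf{B}$ the $\delta^i$ commute, have the same constant field $C$, and $GL^{\delta}(m,F)=g^{-1}GL^{\partial}(m,F)$.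 For each $\delta\in\mathbf{B}$ let $W_\delta\subset F^l$ be a subset ($F^l$ being regarded as a space over the $\delta$-differential field $F$), and let $W=\bigcup_{\delta\in\mathbf{B}}(\delta,W_\delta)$, the set of pairs $(\delta,v)$ with $v\in W_\delta$. It is assumed that an action is given: for each $\delta\in\mathbf{B}$, $(h,g)\in GL(n,F)\times GL^{\delta}(m,F)$ and $v\in W_\delta$, an element $\tau^{\delta}\langle h,g;v\rangle\in W_{g^{-1}\delta}$, such that $\tau^{\delta}\langle I_n,I_m;v\rangle=v$ and $$\tau^{g^{-1}\delta}\langle h_1,g_1;\tau^{\delta}\langle h,g;v\rangle\rangle=\tau^{\delta}\langle hh_1,gg_1;v\rangle$$ for all $h,h_1\in GL(n,F)$, $g\in GL^{\delta}(m,F)$, $g_1\in GL^{g^{-1}\delta}(m,F)$, $v\in W_\delta$. The components of $\tau^\delta$ are $\delta$-differential rational functions over $C$ in the components of $h,g,v$, given by expressions that do not depend on $\delta$ except that the derivations used are $\delta^1,\dots,\delta^m$. $W_0=\bigcup_{\delta}(\delta,W_{0\delta})\subset W$ is a nonempty $G$-invariant subset: $\tau^\delta\langle h,g;v\rangle\in W_{0\,g^{-1}\delta}$ whenever $v\in W_{0\delta}$ and $(h,g)\in GL(n,F)\times GL^\delta(m,F)$. It is assumed that there is given a family of maps $P^{\delta}=(P_0^\delta,P_1^\delta):W_{0\delta}\to GL(n,F)\times GL^{\delta}(m,F)$, $\delta\in\mathbf{B}$, with $$P_0^{g^{-1}\delta}\langle\tau^{\delta}\langle h,g;\mathbf{v}\rangle\rangle=h^{-1}P_0^{\delta}\langle\mathbf{v}\rangle,\qquad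 P_1^{g^{-1}\delta}\langle\tau^{\delta}\langle h,g;\mathbf{v}\rangle\rangle=g^{-1}P_1^{\delta}\langle\mathbf{v}\rangle$$ for all $\delta\in\mathbf{B}$, $\mathbf{v}\in W_{0\delta}$, $(h,g)\in GL(n,F)\times GL^{\delta}(m,F)$, the components of $P^\delta\langle\mathbf{v}\rangle$ being $\delta$-differential rational functions of $\mathbf{v}$ over $C$, given by expressions independent of $\delta$ in the same sense. $\tau^{\delta}\langle P^{\delta}\langle\mathbf{v}\rangle;\mathbf{v}\rangle$ means $\tau^{\delta}\langle P_0^{\delta}\langle\mathbf{v}\rangle,P_1^{\delta}\langle\mathbf{v}\rangle;\mathbf{v}\rangle$. *)

theory Defs
  imports "HOL-Analysis.Analysis" "HOL-Library.Multiset" "HOL-Library.Poly_Mapping"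
begin

type_synonym ('f, 'm) dcol = "('f \<Rightarrow> 'f)^'m"

definition derivation :: "('f::field \<Rightarrow> 'f) \<Rightarrow> bool" where
  "derivation d \<longleftrightarrow> (\<forall>a b. d (a + b) = d a + d b) \<and> (\<forall>a b. d (a * b) = d a * b + a * d b)"

definition commuting_derivations :: "('f::field, 'm::finite) dcol \<Rightarrow> bool" where
  "commuting_derivations \<delta> \<longleftrightarrow>
     (\<forall>i. derivation (\<delta> $ i)) \<and> (\<forall>i j a. (\<delta> $ i) ((\<delta> $ j) a) = (\<delta> $ j) ((\<delta> $ i) a))"

definition lin_independent :: "('f::field, 'm::finite) dcol \<Rightarrow> bool" where
  "lin_independent \<delta> \<longleftrightarrow>
     (\<forall>c :: 'f^'m. (\<forall>a. (\<Sum>i\<in>UNIV. c $ i * (\<delta> $ i) a) = 0) \<longrightarrow> c = 0)"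

definition constants :: "('f::field, 'm::finite) dcol \<Rightarrow> 'f set" where
  "constants \<delta> = {a. \<forall>i. (\<delta> $ i) a = 0}"

definition GL :: "('f::field^'k^'k) set" where
  "GL = {A. invertible A}"

definition GLd :: "('f::field, 'm::finite) dcol \<Rightarrow> ('f^'m^'m) set" where
  "GLd \<delta> = {g \<in> GL. \<forall>i j k. (\<delta> $ i) (g $ j $ k) = (\<delta> $ j) (g $ i $ k)}"

definition matrix_dcol :: "'f::field^'m^'m \<Rightarrow> ('f, 'm::finite) dcol \<Rightarrow> ('f, 'm) dcol" where
  "matrix_dcol A \<delta> = (\<chi> i. (\<lambda>a. \<Sum>j\<in>UNIV. A $ i $ j * (\<delta> $ j) a))"

definition inv_dcol :: "'f::field^'m^'m \<Rightarrow> ('f, 'm::finite) dcol \<Rightarrow> ('f, 'm) dcol" where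
  "inv_dcol g \<delta> = matrix_dcol (matrix_inv g) \<delta>"

definition dcol_class :: "('f::field, 'm::finite) dcol \<Rightarrow> ('f, 'm) dcol set" where
  "dcol_class \<delta> = {inv_dcol g \<delta> |g. g \<in> GLd \<delta>}"

text \<open>
  Formal differential polynomials in the unknowns \<open>'x\<close>, with \<open>'m\<close> indexing the formal derivations.
  A multiset \<open>\<theta>\<close> over \<open>'m\<close> is a derivative operator (a monomial in the commuting derivations), the
  pair \<open>(x, \<theta>)\<close> is the indeterminate \<open>\<theta> x\<close>, and a multiset of such pairs is a monomial.
  Evaluation (at a column of commuting derivations) substitutes the \<open>\<delta> $ i\<close> for the
  formal derivations and \<open>s\<close> for the unknowns.
\<close>

type_synonym ('x, 'm, 'f) dpoly = "(('x \<times> 'm multiset) multiset, 'f) poly_mapping"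

definition deriv_op :: "('f::field, 'm::finite) dcol \<Rightarrow> 'm multiset \<Rightarrow> 'f \<Rightarrow> 'f" where
  "deriv_op \<delta> \<theta> a = fold_mset (\<lambda>i. \<delta> $ i) a \<theta>"

definition dpoly_eval ::
  "('f::field, 'm::finite) dcol \<Rightarrow> ('x \<Rightarrow> 'f) \<Rightarrow> ('x, 'm, 'f) dpoly \<Rightarrow> 'f" where
  "dpoly_eval \<delta> s p =
     (\<Sum>M\<in>Poly_Mapping.keys p. Poly_Mapping.lookup p M * (\<Prod>(x, \<theta>)\<in>#M. deriv_op \<delta> \<theta> (s x)))"

text \<open>
  A differential rational function over \<open>C\<close> is represented by a pair (numerator, denominator).
  It has a value only where the denominator does not vanish.
\<close>

definition drat_over :: "'f::field set \<Rightarrow> (('x, 'm, 'f) dpoly \<times> ('x, 'm, 'f) dpoly) set" where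
  "drat_over C = {(p, q). q \<noteq> 0 \<and> (\<forall>M. Poly_Mapping.lookup p M \<in> C \<and> Poly_Mapping.lookup q M \<in> C)}"

definition drat_value ::
  "('x, 'm, 'f) dpoly \<times> ('x, 'm, 'f) dpoly \<Rightarrow> ('f::field, 'm::finite) dcol \<Rightarrow> ('x \<Rightarrow> 'f) \<Rightarrow> 'f \<Rightarrow> bool" where
  "drat_value r \<delta> s y \<longleftrightarrow>
     dpoly_eval \<delta> s (snd r) \<noteq> 0 \<and> y = dpoly_eval \<delta> s (fst r) / dpoly_eval \<delta> s (snd r)"

text \<open>The unknowns of \<open>\<tau>\<^sup>\<delta>\<langle>h, g; v\<rangle>\<close>: the entries of \<open>h\<close>, of \<open>g\<close> and of \<open>v\<close>.\<close>

datatype ('n, 'm, 'l) tau_var = HVar 'n 'n | GVar 'm 'm | VVar 'l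

primrec tau_args ::
  "'f^'n^'n \<Rightarrow> 'f^'m^'m \<Rightarrow> 'f^'l \<Rightarrow> ('n::finite, 'm::finite, 'l::finite) tau_var \<Rightarrow> 'f" where
  "tau_args h g v (HVar i j) = h $ i $ j"
| "tau_args h g v (GVar i j) = g $ i $ j"
| "tau_args h g v (VVar i) = v $ i"

definition G_equivalent ::
  "(('f::field, 'm::finite) dcol \<Rightarrow> 'f^'n^'n \<Rightarrow> 'f^'m^'m \<Rightarrow> 'f^'l \<Rightarrow> 'f^'l) \<Rightarrow>
   ('f, 'm) dcol \<times> ('f^'l) \<Rightarrow> ('f, 'm) dcol \<times> ('f^'l) \<Rightarrow> bool" where
  "G_equivalent \<tau> = (\<lambda>(\<delta>, u) (\<delta>', v).
     \<exists>h \<in> GL. \<exists>g \<in> GLd \<delta>. \<delta>' = inv_dcol g \<delta> \<and> v = \<tau> \<delta> h g u)"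

end

theory Submission
  imports Defs
begin

text \<open>
  If \<open>v = \<tau>\<^sup>\<partial>\<langle>h, g; u\<rangle>\<close> with \<open>\<delta> = g\<^sup>-\<^sup>1\<partial>\<close>, equivariance of \<open>P\<close> and the action law give
  \<open>\<tau>\<^sup>\<delta>\<langle>P\<^sup>\<delta>\<langle>v\<rangle>; v\<rangle> = \<tau>\<^sup>\<partial>\<langle>P\<^sup>\<partial>\<langle>u\<rangle>; u\<rangle>\<close>. For constant \<open>v\<close> the left-hand side is constant, because differential
  rational functions over \<open>C\<close> take constants to constants. Conversely \<open>(P\<^sub>0\<langle>u\<rangle>, P\<^sub>1\<langle>u\<rangle>)\<close> is itself
  the group element that carries \<open>u\<close> to a constant vector.
\<close>

lemma derivation_add: "derivation d \<Longrightarrow> d (a + b) = d a + d b"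
  by (simp add: derivation_def)

lemma derivation_mult: "derivation d \<Longrightarrow> d (a * b) = d a * b + a * d b"
  by (simp add: derivation_def)

lemma derivation_zero:
  assumes "derivation d"
  shows "d 0 = 0"
  using derivation_add[OF assms, of 0 0] by (metis add_0 add_cancel_right_right)

lemma derivation_one:
  assumes "derivation d"
  shows "d 1 = 0"
  using derivation_mult[OF assms, of 1 1] by (metis add_cancel_right_right mult_1 mult_1_right)

text \<open>Differentiate \<open>a * inverse a = 1\<close>. For \<open>a = 0\<close> the convention
  \<open>inverse 0 = 0\<close> reduces the claim to the assumption.\<close>

lemma derivation_inverse_eq_zero:
  assumes d: "derivation d" and a: "d a = 0"
  shows "d (inverse a) = 0"
proof (cases "a = 0")
  case True
  then show ?thesis using a by simp
next
  case False
  have "a * d (inverse a) = d (a * inverse a)"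
    by (simp add: derivation_mult[OF d] a)
  also have "\<dots> = 0" using False by (simp add: derivation_one[OF d])
  finally show ?thesis using False by simp
qed

context
  fixes D :: "('f::field, 'm::finite) dcol"
  assumes derivations: "\<And>i. derivation (D $ i)"
begin

lemma constants_zero: "0 \<in> constants D"
  by (simp add: constants_def derivation_zero derivations)

lemma constants_one: "1 \<in> constants D"
  by (simp add: constants_def derivation_one derivations)

lemma constants_add: "a \<in> constants D \<Longrightarrow> b \<in> constants D \<Longrightarrow> a + b \<in> constants D"
  by (simp add: constants_def derivation_add derivations)

lemma constants_mult: "a \<in> constants D \<Longrightarrow> b \<in> constants D \<Longrightarrow> a * b \<in> constants D"
  by (simp add: constants_def derivation_mult derivations)

lemma constants_divide: "a \<in> constants D \<Longrightarrow> b \<in> constants D \<Longrightarrow> a / b \<in> constants D"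
  unfolding divide_inverse
  by (rule constants_mult) (simp_all add: constants_def derivation_inverse_eq_zero derivations)

lemma constants_sum: "(\<And>x. x \<in> A \<Longrightarrow> f x \<in> constants D) \<Longrightarrow> sum f A \<in> constants D"
  \<comment> \<open>An infinite index set gives the default sum 0, again a constant.\<close>
  by (induction A rule: infinite_finite_induct) (auto intro: constants_zero constants_add)

lemma constants_prod_mset:
  "(\<And>x. x \<in># M \<Longrightarrow> f x \<in> constants D) \<Longrightarrow> (\<Prod>x\<in>#M. f x) \<in> constants D"
  by (induction M) (auto intro: constants_one constants_mult)

text \<open>
  \<open>fold_mset\<close> is unspecified for steps that do not commute. On constants
  every step is the zero map, so commutativity of \<open>\<delta>\<close> need not be established.
\<close>

lemma deriv_op_constant:
  fixes \<delta> :: "('f, 'k::finite) dcol"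
  assumes "constants D \<subseteq> constants \<delta>" and a: "a \<in> constants D"
  shows "deriv_op \<delta> \<theta> a \<in> constants D"
proof -
  have zero: "(\<delta> $ i) b = 0" if "b \<in> constants D" for i b
    using assms(1) that by (auto simp: constants_def)
  \<comment> \<open>\<open>k > 0\<close> matters: the zeroth iterate is the identity, which does not
    kill constants.\<close>
  have step: "((\<delta> $ i) ^^ k) b = 0" if "k > 0" "b \<in> constants D" for i k b
    using that(1)
  proof (induction k rule: nat_induct_non_zero)
    case 1
    then show ?case using zero that(2) by simp
  next
    case (Suc k)
    then show ?case using zero[OF constants_zero] by simp
  qed
  have "deriv_op \<delta> \<theta> a = Finite_Set.fold (\<lambda>i. (\<delta> $ i) ^^ count \<theta> i) a (set_mset \<theta>)"
    by (simp add: deriv_op_def fold_mset_def)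
  also have "\<dots> = Finite_Set.fold (\<lambda>_ _. 0) a (set_mset \<theta>)"
    \<comment> \<open>Every \<open>i\<close> in the support has positive count, so its iterate
      agrees with the zero map on \<open>constants D\<close>, and 0 stays in that set.\<close>
    by (rule fold_closed_eq[where B = "constants D"]) (auto simp: step constants_zero a)
  also have "\<dots> = (if set_mset \<theta> = {} then a else 0)"
  proof -
    \<comment> \<open>Constant maps commute, so this fold can be evaluated by insertion. The empty
      operator returns \<open>a\<close>, any other returns 0.\<close>
    interpret comp_fun_commute "\<lambda>(_::'k) (_::'f). (0::'f)"
      by unfold_locales auto
    have "Finite_Set.fold (\<lambda>_ _. 0) a A = (if A = {} then a else 0)" if "finite A" for A :: "'k set"
      using that by (induction A rule: finite_induct) simp_all
    then show ?thesis by simp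
  qed
  finally show ?thesis using a constants_zero by simp
qed

lemma dpoly_eval_constant:
  assumes "constants D \<subseteq> constants \<delta>" and "\<And>x. s x \<in> constants D"
    and "\<And>M. Poly_Mapping.lookup p M \<in> constants D"
  shows "dpoly_eval \<delta> s p \<in> constants D"
  unfolding dpoly_eval_def
  by (intro constants_sum constants_mult constants_prod_mset assms)
    (auto intro!: deriv_op_constant assms)

text \<open>Two columns occur because \<open>C\<close> is fixed by the initial column
  \<open>D\<close>, while expressions at an equivalent point are evaluated with the transformed
  column \<open>\<delta>\<close>.\<close>

lemma drat_value_constant:
  assumes "constants D \<subseteq> constants \<delta>" and "\<And>x. s x \<in> constants D"
    and "r \<in> drat_over (constants D)" and "drat_value r \<delta> s y"
  shows "y \<in> constants D"
  using assms
  by (auto simp: drat_value_def drat_over_def intro!: constants_divide dpoly_eval_constant)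

end

text \<open>Each entry of \<open>inv_dcol g \<delta>\<close> is an F-linear combination of the
  entries of \<open>\<delta>\<close>, so it kills whatever they all kill.\<close>

lemma constants_subset_inv_dcol: "constants \<delta> \<subseteq> constants (inv_dcol g \<delta>)"
  by (auto simp: constants_def inv_dcol_def matrix_dcol_def)

lemma matrix_mul_inv_cancel:
  fixes A X :: "'f::field^'k^'k"
  assumes "A \<in> GL"
  shows "A ** (matrix_inv A ** X) = X"
proof -
  \<comment> \<open>\<open>matrix_inv\<close> is a choice among two-sided inverses; invertibility
    makes that choice meaningful.\<close>
  have "A ** matrix_inv A = mat 1"
    using assms unfolding GL_def invertible_def matrix_inv_def
    by (metis (mono_tags, lifting) mem_Collect_eq someI_ex)
  then show ?thesis by (simp add: matrix_mul_assoc)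
qed

theorem theorem2p3:
  fixes D :: "('f::field, 'm::finite) dcol"
    and B :: "('f, 'm) dcol set"
    and C :: "'f set"
    and W W0 :: "('f, 'm) dcol \<Rightarrow> ('f^'l::finite) set"
    and \<tau> :: "('f, 'm) dcol \<Rightarrow> 'f^'n^'n \<Rightarrow> 'f^'m^'m \<Rightarrow> 'f^'l \<Rightarrow> 'f^('l::finite)"
    and P0 :: "('f, 'm) dcol \<Rightarrow> 'f^'l \<Rightarrow> 'f^('n::finite)^'n"
    and P1 :: "('f, 'm) dcol \<Rightarrow> 'f^'l \<Rightarrow> 'f^'m^'m"
    and u :: "'f^'l"
  assumes commuting: "commuting_derivations D"
    and independent: "lin_independent D"
    and B_def: "B = dcol_class D"
    and C_def: "C = constants D"
    and tau_closed: "\<And>\<delta> h g v. \<delta> \<in> B \<Longrightarrow> h \<in> GL \<Longrightarrow> g \<in> GLd \<delta> \<Longrightarrow> v \<in> W \<delta> \<Longrightarrow>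
        \<tau> \<delta> h g v \<in> W (inv_dcol g \<delta>)"
    and tau_one: "\<And>\<delta> v. \<delta> \<in> B \<Longrightarrow> v \<in> W \<delta> \<Longrightarrow> \<tau> \<delta> (mat 1) (mat 1) v = v"
    and tau_mult: "\<And>\<delta> h h1 g g1 v. \<delta> \<in> B \<Longrightarrow> h \<in> GL \<Longrightarrow> h1 \<in> GL \<Longrightarrow> g \<in> GLd \<delta> \<Longrightarrow>
        g1 \<in> GLd (inv_dcol g \<delta>) \<Longrightarrow> v \<in> W \<delta> \<Longrightarrow>
        \<tau> (inv_dcol g \<delta>) h1 g1 (\<tau> \<delta> h g v) = \<tau> \<delta> (h ** h1) (g ** g1) v"
    and tau_rational: "\<And>k. \<exists>r \<in> drat_over C. \<forall>\<delta> \<in> B. \<forall>h \<in> GL. \<forall>g \<in> GLd \<delta>. \<forall>v \<in> W \<delta>.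
        drat_value r \<delta> (tau_args h g v) (\<tau> \<delta> h g v $ k)"
    and W0_subset: "\<And>\<delta>. \<delta> \<in> B \<Longrightarrow> W0 \<delta> \<subseteq> W \<delta>"
    and W0_nonempty: "(SIGMA \<delta>:B. W0 \<delta>) \<noteq> {}"
    and W0_invariant: "\<And>\<delta> h g v. \<delta> \<in> B \<Longrightarrow> h \<in> GL \<Longrightarrow> g \<in> GLd \<delta> \<Longrightarrow> v \<in> W0 \<delta> \<Longrightarrow>
        \<tau> \<delta> h g v \<in> W0 (inv_dcol g \<delta>)"
    and P0_GL: "\<And>\<delta> v. \<delta> \<in> B \<Longrightarrow> v \<in> W0 \<delta> \<Longrightarrow> P0 \<delta> v \<in> GL"
    and P1_GLd: "\<And>\<delta> v. \<delta> \<in> B \<Longrightarrow> v \<in> W0 \<delta> \<Longrightarrow> P1 \<delta> v \<in> GLd \<delta>"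
    and P0_equivariant: "\<And>\<delta> h g v. \<delta> \<in> B \<Longrightarrow> v \<in> W0 \<delta> \<Longrightarrow> h \<in> GL \<Longrightarrow> g \<in> GLd \<delta> \<Longrightarrow>
        P0 (inv_dcol g \<delta>) (\<tau> \<delta> h g v) = matrix_inv h ** P0 \<delta> v"
    and P1_equivariant: "\<And>\<delta> h g v. \<delta> \<in> B \<Longrightarrow> v \<in> W0 \<delta> \<Longrightarrow> h \<in> GL \<Longrightarrow> g \<in> GLd \<delta> \<Longrightarrow>
        P1 (inv_dcol g \<delta>) (\<tau> \<delta> h g v) = matrix_inv g ** P1 \<delta> v"
    and P0_rational: "\<And>i j. \<exists>r \<in> drat_over C. \<forall>\<delta> \<in> B. \<forall>v \<in> W0 \<delta>.
        drat_value r \<delta> (\<lambda>k. v $ k) (P0 \<delta> v $ i $ j)"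
    and P1_rational: "\<And>i j. \<exists>r \<in> drat_over C. \<forall>\<delta> \<in> B. \<forall>v \<in> W0 \<delta>.
        drat_value r \<delta> (\<lambda>k. v $ k) (P1 \<delta> v $ i $ j)"
    and u_in: "(D, u) \<in> (SIGMA \<delta>:B. W0 \<delta>)"
  shows "(\<exists>(\<delta>, v) \<in> (SIGMA \<delta>:B. W0 \<delta>). (\<forall>k. v $ k \<in> C) \<and> G_equivalent \<tau> (D, u) (\<delta>, v)) \<longleftrightarrow>
         (\<forall>k. \<tau> D (P0 D u) (P1 D u) u $ k \<in> C)"
proof
  have DB: "D \<in> B" and uW0: "u \<in> W0 D" using u_in by auto
  have uW: "u \<in> W D" using W0_subset DB uW0 by auto
  have inv_B: "inv_dcol g D \<in> B" if "g \<in> GLd D" for g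
    using that by (auto simp: B_def dcol_class_def)
  have der: "derivation (D $ i)" for i
    using commuting by (simp add: commuting_derivations_def)
  {
    assume "\<exists>(\<delta>, v) \<in> (SIGMA \<delta>:B. W0 \<delta>). (\<forall>k. v $ k \<in> C) \<and> G_equivalent \<tau> (D, u) (\<delta>, v)"
    \<comment> \<open>Equivalence determines the target pair from \<open>h\<close> and
      \<open>g\<close>, so only these are extracted.\<close>
    then obtain h g where h: "h \<in> GL" and g: "g \<in> GLd D"
      and const: "\<And>k. \<tau> D h g u $ k \<in> C"
      by (auto simp: G_equivalent_def)
    define \<delta> where "\<delta> = inv_dcol g D"
    define v where "v = \<tau> D h g u"
    have gGL: "g \<in> GL" using g by (simp add: GLd_def)
    have \<delta>B: "\<delta> \<in> B" using inv_B g by (simp add: \<delta>_def)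
    have vW0: "v \<in> W0 \<delta>" using W0_invariant DB h g uW0 by (simp add: \<delta>_def v_def)
    have vW: "v \<in> W \<delta>" using W0_subset \<delta>B vW0 by auto
    have vC: "v $ k \<in> C" for k using const by (simp add: v_def)
    have sub: "constants D \<subseteq> constants \<delta>"
      unfolding \<delta>_def by (rule constants_subset_inv_dcol)
    have P0C: "P0 \<delta> v $ i $ j \<in> C" for i j
      using P0_rational[of i j] drat_value_constant[OF der sub] vC \<delta>B vW0 C_def by metis
    have P1C: "P1 \<delta> v $ i $ j \<in> C" for i j
      using P1_rational[of i j] drat_value_constant[OF der sub] vC \<delta>B vW0 C_def by metis
    \<comment> \<open>With the entries of \<open>P0\<close>, \<open>P1\<close> and \<open>v\<close>
      constant, every unknown substituted into \<open>\<tau>\<close> is constant.\<close>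
    have args: "tau_args (P0 \<delta> v) (P1 \<delta> v) v x \<in> C" for x
      by (cases x) (simp_all add: P0C P1C vC)
    have in_G: "P0 \<delta> v \<in> GL" "P1 \<delta> v \<in> GLd \<delta>"
      using P0_GL P1_GLd \<delta>B vW0 by auto
    have "\<tau> \<delta> (P0 \<delta> v) (P1 \<delta> v) v = \<tau> D (h ** P0 \<delta> v) (g ** P1 \<delta> v) u"
      using tau_mult[OF DB h in_G(1) g in_G(2)[unfolded \<delta>_def] uW] by (simp add: \<delta>_def v_def)
    \<comment> \<open>By equivariance \<open>P0 \<delta> v\<close> carries the factor
      \<open>matrix_inv h\<close>, which \<open>h\<close> cancels; likewise for \<open>g\<close>
      below.\<close>
    also have "h ** P0 \<delta> v = P0 D u"
      using P0_equivariant[OF DB uW0 h g] matrix_mul_inv_cancel[OF h]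
      by (simp add: \<delta>_def v_def)
    also have "g ** P1 \<delta> v = P1 D u"
      using P1_equivariant[OF DB uW0 h g] matrix_mul_inv_cancel[OF gGL]
      by (simp add: \<delta>_def v_def)
    finally have eq: "\<tau> \<delta> (P0 \<delta> v) (P1 \<delta> v) v = \<tau> D (P0 D u) (P1 D u) u" .
    have "\<tau> \<delta> (P0 \<delta> v) (P1 \<delta> v) v $ k \<in> C" for k
    proof -
      obtain r where "r \<in> drat_over C"
        and "drat_value r \<delta> (tau_args (P0 \<delta> v) (P1 \<delta> v) v) (\<tau> \<delta> (P0 \<delta> v) (P1 \<delta> v) v $ k)"
        using tau_rational[of k] \<delta>B in_G vW by blast
      then show ?thesis
        using drat_value_constant[OF der sub] args C_def by metis
    qed
    then show "\<forall>k. \<tau> D (P0 D u) (P1 D u) u $ k \<in> C" by (simp add: eq)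
  }
  {
    assume const: "\<forall>k. \<tau> D (P0 D u) (P1 D u) u $ k \<in> C"
    have in_G: "P0 D u \<in> GL" "P1 D u \<in> GLd D"
      using P0_GL P1_GLd DB uW0 by auto
    \<comment> \<open>The new column lies in \<open>B\<close> because \<open>P1 D u\<close> is in
      \<open>GLd D\<close>; invariance keeps the new vector in \<open>W0\<close>.\<close>
    have "(inv_dcol (P1 D u) D, \<tau> D (P0 D u) (P1 D u) u) \<in> (SIGMA \<delta>:B. W0 \<delta>)"
      using inv_B W0_invariant DB uW0 in_G by simp
    moreover have "G_equivalent \<tau> (D, u) (inv_dcol (P1 D u) D, \<tau> D (P0 D u) (P1 D u) u)"
      using in_G by (auto simp: G_equivalent_def)
    ultimately show "\<exists>(\<delta>, v) \<in> (SIGMA \<delta>:B. W0 \<delta>). (\<forall>k. v $ k \<in> C) \<and> G_equivalent \<tau> (D, u) (\<delta>, v)"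
      using const by blast
  }
qed

end
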